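(* Let $u\ge 3$ and let $K_1,\dots,K_u\subset\mathbb{R}^3$ be pairwise disjoint closed round balls such that for all pairwise distinct $i,j,k$ the convex hull of $K_i\cup K_j$ does not meet $K_k$. For $i\ne j$ let $(p_{ij},p_{ji})\in K_i\times K_j$ be the minimiser of $\|q_1-q_2\|$ over $(q_1,q_2)\in K_i\times K_j$, and let $H$ be the convex hull of $\{p_{ij}:1\le i,j\le u,\ i\ne j\}$. Let $\alpha_1,\dots,\alpha_n\in\{1,\dots,u\}$ $(n\ge 3)$ be a finite sequence of indices and let $(q_1,\dots,q_n)$ be the successive reflection points of a periodic billiard trajectory in the exterior of $K=K_1\cup\dots\cup K_u$ with $q_j\in K_{\alpha_j}$ for each $j$. Then $q_j\in H$ for every $j$. Furthermore, $\pi(M_0)\subset H$, where $M_0$ is the non-wandering set of the billiard ball map in the exterior of $K$.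
   Context: Billiard. $Q=\overline{\mathbb{R}^3\setminus K}$; $n_K(q)$ is the unit normal to $\partial K$ at $q$ pointing out of $K$. A particle moves in $Q$ with unit speed along straight lines and reflects at $\partial K$ by $v^+=v^--2\langle v^-,n\rangle n$. Let $M=\{(q,v)\in\partial K\times\mathbb{S}^{2}:\langle n_K(q),v\rangle\ge0\}$ and $\pi(q,v)=q$. The billiard ball map $B$ sends $x\in M$ whose forward trajectory hits $\partial K$ again to the point of $M$ (position, outgoing velocity) at its next reflection. $M_0$ is the set of $x\in M$ whose trajectory has infinitely many reflections both forward and backward in time. *)

theory Defs
  imports "HOL-Analysis.Analysis"
begin

definition billiard_table :: "'a::euclidean_space set \<Rightarrow> 'a set" where
  "billiard_table K = closure (- K)"

text \<open>A unit vector is normal to the boundary at \<open>q\<close> if it is orthogonal to the velocity of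
  every differentiable curve in the boundary through \<open>q\<close>; the last clause makes it point out
  of \<open>K\<close>. Where the boundary is a smooth hypersurface with \<open>K\<close> on one side, there is exactly
  one such vector.\<close>
definition is_outward_unit_normal :: "'a::euclidean_space set \<Rightarrow> 'a \<Rightarrow> 'a \<Rightarrow> bool" where
  "is_outward_unit_normal K q n \<longleftrightarrow>
     norm n = 1 \<and>
     (\<forall>\<gamma> w. (\<forall>t::real. \<gamma> t \<in> frontier K) \<and> \<gamma> 0 = q \<and> (\<gamma> has_vector_derivative w) (at 0)
            \<longrightarrow> inner n w = 0) \<and>
     (\<forall>\<^sub>F t in at_right (0::real). q + t *\<^sub>R n \<notin> K)"

definition outward_unit_normal :: "'a::euclidean_space set \<Rightarrow> 'a \<Rightarrow> 'a" where
  "outward_unit_normal K q = (THE n. is_outward_unit_normal K q n)"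

definition reflected_velocity :: "'a::real_inner \<Rightarrow> 'a \<Rightarrow> 'a" where
  "reflected_velocity n v = v - (2 * inner v n) *\<^sub>R n"

definition billiard_phase_space :: "'a::euclidean_space set \<Rightarrow> ('a \<times> 'a) set" where
  "billiard_phase_space K =
     {(q, v). q \<in> frontier K \<and> v \<in> sphere 0 1 \<and> 0 \<le> inner (outward_unit_normal K q) v}"

text \<open>The speed is one, so \<open>t\<close> is also the length of the free path. A tangential contact counts
  as a reflection (one that leaves the velocity unchanged).\<close>
definition is_next_reflection_time :: "'a::euclidean_space set \<Rightarrow> 'a \<times> 'a \<Rightarrow> real \<Rightarrow> bool" where
  "is_next_reflection_time K x t \<longleftrightarrow>
     0 < t \<and> fst x + t *\<^sub>R snd x \<in> frontier K \<and>
     (\<forall>s. 0 < s \<and> s < t \<longrightarrow> fst x + s *\<^sub>R snd x \<in> billiard_table K - frontier K)"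

text \<open>The billiard ball map is partial: \<open>billiard_map K\<close> is meaningful only on
  \<open>billiard_dom K\<close>.\<close>
definition billiard_dom :: "'a::euclidean_space set \<Rightarrow> ('a \<times> 'a) set" where
  "billiard_dom K = {x \<in> billiard_phase_space K. \<exists>t. is_next_reflection_time K x t}"

definition billiard_map :: "'a::euclidean_space set \<Rightarrow> 'a \<times> 'a \<Rightarrow> 'a \<times> 'a" where
  "billiard_map K x =
     (let t = (THE t. is_next_reflection_time K x t);
          q = fst x + t *\<^sub>R snd x
      in (q, reflected_velocity (outward_unit_normal K q) (snd x)))"

text \<open>Following usage in the theory of open billiards, the non-wandering set consists of the points
  with infinitely many reflections both forward and backward in time, i.e. those on a
  two-sided infinite orbit of the billiard ball map.\<close>
definition billiard_nonwandering :: "'a::euclidean_space set \<Rightarrow> ('a \<times> 'a) set" where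
  "billiard_nonwandering K =
     {x \<in> billiard_phase_space K. \<exists>z :: int \<Rightarrow> 'a \<times> 'a. z 0 = x \<and>
          (\<forall>k. z k \<in> billiard_dom K \<and> billiard_map K (z k) = z (k + 1))}"

text \<open>The points are indexed by \<open>1, \<dots>, n\<close>; the successor of index \<open>j\<close> is
  \<open>j mod n + 1\<close>, so that \<open>n\<close> is followed by \<open>1\<close>. The number \<open>n\<close> is a period, not
  necessarily the least one.\<close>
definition periodic_reflection_points ::
    "'a::euclidean_space set \<Rightarrow> nat \<Rightarrow> (nat \<Rightarrow> 'a) \<Rightarrow> bool" where
  "periodic_reflection_points K n q \<longleftrightarrow>
     (\<exists>v. \<forall>j\<in>{1..n}. (q j, v j) \<in> billiard_dom K \<and>
            billiard_map K (q j, v j) = (q (j mod n + 1), v (j mod n + 1)))"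

end

theory Submission
  imports Defs
begin

text \<open>Let \<open>P\<close> be the nearest-point projection onto \<open>H\<close>. It is 1-Lipschitz, and it maps every ball
  of the family into itself. Let \<open>q k\<close>, \<open>v k\<close> be the points and outgoing velocities of a two-sided
  orbit, and put \<open>y k = q k - P (q k)\<close> and \<open>a k = \<langle>y k, v (k - 1)\<rangle>\<close>. As \<open>P\<close> does not
  increase the length of the link from \<open>q k\<close> to \<open>q (k + 1)\<close>, we have
  \<open>\<langle>y k, v k\<rangle> \<le> a (k + 1)\<close>; and \<open>v k - v (k - 1)\<close> is an outward normal at \<open>q k\<close>, whose length
  is bounded below because no ball meets the convex hull of two others. Strict convexity of
  the balls then gives \<open>a (k + 1) \<ge> a k + \<epsilon> (norm (y k))\<^sup>2 \<ge> a k + \<epsilon> (a k)\<^sup>2\<close>. A bounded two-sided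
  sequence can satisfy this only if it vanishes, so \<open>y = 0\<close> and all \<open>q k\<close> lie in \<open>H\<close>. Periodic
  trajectories are the special case of periodic two-sided orbits.\<close>

section \<open>Bounded real sequences with quadratic growth\<close>

lemma linear_growth_unbounded:
  fixes f :: "nat \<Rightarrow> real"
  assumes "0 < e" and step: "\<And>n. f n + e \<le> f (Suc n)" and bound: "\<And>n. f n \<le> D"
  shows False
proof -
  have lin: "f 0 + of_nat n * e \<le> f n" for n
  proof (induction n)
    case (Suc n)
    then show ?case using step[of n] by (simp add: algebra_simps)
  qed simp
  obtain n :: nat where "D - f 0 < of_nat n * e"
    using \<open>0 < e\<close> ex_less_of_nat_mult by blast
  then show False using lin[of n] bound[of n] by linarith
qed

text \<open>The sequence is nondecreasing. If \<open>a m\<close> is positive, all later terms are at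
  least \<open>a m\<close>, so every forward step gains at least \<open>e * (a m)\<^sup>2\<close>.
  If it is negative, all earlier terms are at most \<open>a m\<close>, and every backward step loses
  that much. Either way boundedness fails; the negative case is where the past of the sequence is
  used.\<close>

lemma bounded_quadratic_growth_zero:
  fixes a :: "int \<Rightarrow> real"
  assumes "0 < e" and step: "\<And>k. a k + e * (a k)\<^sup>2 \<le> a (k + 1)" and bound: "\<And>k. \<bar>a k\<bar> \<le> D"
  shows "a m = 0"
proof (rule ccontr)
  assume "a m \<noteq> 0"
  then have pos: "0 < e * (a m)\<^sup>2" using \<open>0 < e\<close> by simp
  have mono: "a k \<le> a (k + 1)" for k
    using step[of k] \<open>0 < e\<close> by (smt (verit) mult_nonneg_nonneg zero_le_power2)
  show False
  proof (cases "0 < a m")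
    case True
    have ge: "a m \<le> a (m + int n)" for n
    proof (induction n)
      case (Suc n)
      then show ?case using mono[of "m + int n"] by (simp add: algebra_simps)
    qed simp
    have "a (m + int n) + e * (a m)\<^sup>2 \<le> a (m + int (Suc n))" for n
    proof -
      have "(a m)\<^sup>2 \<le> (a (m + int n))\<^sup>2" using ge[of n] True by (simp add: power_mono)
      then have "e * (a m)\<^sup>2 \<le> e * (a (m + int n))\<^sup>2" using \<open>0 < e\<close> by simp
      then show ?thesis using step[of "m + int n"] by (simp add: algebra_simps)
    qed
    moreover have "a (m + int n) \<le> D" for n using bound[of "m + int n"] by simp
    ultimately show False using linear_growth_unbounded[OF pos, of "\<lambda>n. a (m + int n)" D] by simp
  next
    case False
    have le: "a (m - int n) \<le> a m" for n
    proof (induction n)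
      case (Suc n)
      then show ?case using mono[of "m - int (Suc n)"] by simp
    qed simp
    have "- a (m - int n) + e * (a m)\<^sup>2 \<le> - a (m - int (Suc n))" for n
    proof -
      have "(a m)\<^sup>2 \<le> (a (m - int (Suc n)))\<^sup>2"
        using power_mono[of "- a m" "- a (m - int (Suc n))" 2] le[of "Suc n"] False by simp
      then have "e * (a m)\<^sup>2 \<le> e * (a (m - int (Suc n)))\<^sup>2" using \<open>0 < e\<close> by simp
      then show ?thesis using step[of "m - int (Suc n)"] by simp
    qed
    moreover have "- a (m - int n) \<le> D" for n using bound[of "m - int n"] by simp
    ultimately show False using linear_growth_unbounded[OF pos, of "\<lambda>n. - a (m - int n)" D] by simp
  qed
qed

section \<open>Euclidean geometry of balls and segments\<close>

text \<open>Quantitative strict convexity of a ball, obtained by expanding the square of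
  \<open>norm ((q - c) - y) \<le> r\<close>: a chord \<open>y\<close> from a boundary point has a
  normal component at least quadratic in its length.\<close>

lemma norm_power2_le_inner_sphere_normal:
  fixes q c y :: "'a::real_inner"
  assumes "0 < r" "norm (q - c) = r" "q - y \<in> cball c r"
  shows "(norm y)\<^sup>2 \<le> 2 * r * inner y ((q - c) /\<^sub>R r)"
proof -
  have "norm ((q - c) - y) \<le> r"
    using assms(3) by (simp add: dist_norm norm_minus_commute algebra_simps)
  then have "(norm ((q - c) - y))\<^sup>2 \<le> r\<^sup>2" by (simp add: power_mono)
  moreover have "(norm ((q - c) - y))\<^sup>2 = r\<^sup>2 - 2 * inner y (q - c) + (norm y)\<^sup>2"
    unfolding assms(2)[symmetric] power2_norm_eq_inner
    by (simp add: inner_diff_left inner_diff_right inner_commute)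
  ultimately have "(norm y)\<^sup>2 \<le> 2 * inner y (q - c)" by linarith
  also have "\<dots> = 2 * r * inner y ((q - c) /\<^sub>R r)" using assms(1) by simp
  finally show ?thesis .
qed

lemma norm_power2_orthonormal:
  fixes n f :: "'a::real_inner"
  assumes "inner n n = 1" "inner f f = 1" "inner n f = 0"
  shows "(norm (a *\<^sub>R n + b *\<^sub>R f))\<^sup>2 = a\<^sup>2 + b\<^sup>2"
  unfolding power2_norm_eq_inner using assms
  by (simp add: inner_add_left inner_add_right inner_commute power2_eq_square)

text \<open>Comparison with two points on the segment of centres bounds the minimal distance by
  \<open>d - r - s\<close>. The path from \<open>a\<close> through \<open>p\<close> and
  \<open>p'\<close> to \<open>b\<close> then has no slack in the triangle inequality, which forces
  \<open>p\<close> onto that segment at distance \<open>r\<close> from \<open>a\<close>.\<close>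

lemma nearest_point_between_cballs:
  fixes a b p p' :: "'a::real_inner"
  assumes "0 \<le> r" "0 \<le> s" "r + s < dist a b"
    and "p \<in> cball a r" "p' \<in> cball b s"
    and minimal: "\<And>x y. x \<in> cball a r \<Longrightarrow> y \<in> cball b s \<Longrightarrow> norm (p - p') \<le> norm (x - y)"
  shows "p = a + (r / dist a b) *\<^sub>R (b - a)"
proof -
  define d where "d = dist a b"
  have d: "0 < d" "norm (b - a) = d"
    using assms(1-3) by (auto simp: d_def dist_norm norm_minus_commute)
  \<comment> \<open>The points where the segment of centres leaves the first ball and enters the
    second.\<close>
  define x where "x = a + (r / d) *\<^sub>R (b - a)"
  define y where "y = b - (s / d) *\<^sub>R (b - a)"
  have "x \<in> cball a r" "y \<in> cball b s"
    using d assms(1,2) by (auto simp: x_def y_def dist_norm)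
  then have "norm (p - p') \<le> norm (x - y)" by (rule minimal)
  also have "x - y = - ((1 - r / d - s / d) *\<^sub>R (b - a))"
    by (simp add: x_def y_def algebra_simps)
  also have "norm \<dots> = (1 - r / d - s / d) * d"
  proof -
    have "(r + s) / d \<le> 1" using d assms(3) by (simp add: d_def[symmetric])
    then have "0 \<le> 1 - r / d - s / d" by (simp add: add_divide_distrib)
    then show ?thesis by (simp only: norm_minus_cancel norm_scaleR d(2) abs_of_nonneg)
  qed
  also have "\<dots> = d - r - s" using d by (simp add: field_simps)
  finally have pp: "norm (p - p') \<le> d - r - s" .
  have "norm (b - p) \<le> norm (b - p') + norm (p - p')"
    using norm_triangle_ineq[of "b - p'" "p' - p"] by (simp add: norm_minus_commute)
  then have bp: "norm (b - p) \<le> d - r"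
    using pp assms(5) by (simp add: dist_norm)
  have pa: "norm (p - a) \<le> r" using assms(4) by (simp add: dist_norm norm_minus_commute)
  have "(norm (b - p))\<^sup>2 \<le> (d - r)\<^sup>2" using bp by (simp add: power_mono)
  moreover have "(norm (b - p))\<^sup>2 = d\<^sup>2 - 2 * inner (b - a) (p - a) + (norm (p - a))\<^sup>2"
    unfolding d(2)[symmetric] power2_norm_eq_inner
    by (simp add: inner_diff_left inner_diff_right inner_commute)
  ultimately have i: "2 * d * r + (norm (p - a))\<^sup>2 - r\<^sup>2 \<le> 2 * inner (b - a) (p - a)"
    by (simp add: power2_eq_square algebra_simps)
  have pa2: "(norm (p - a))\<^sup>2 \<le> r\<^sup>2" using pa by (simp add: power_mono)
  have "norm (b - a) \<le> norm (b - p) + norm (p - a)"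
    by (metis diff_add_cancel add_diff_eq norm_triangle_ineq)
  then have na: "norm (p - a) = r" using d bp pa by simp
  \<comment> \<open>With \<open>norm (p - a) = r\<close>, the bound \<open>i\<close> gives
    \<open>d * r \<le> inner (b - a) (p - a)\<close>, the equality case of Cauchy-Schwarz; hence the
    distance from \<open>p\<close> to the claimed point is zero.\<close>
  have "(norm ((p - a) - (r / d) *\<^sub>R (b - a)))\<^sup>2
      = (norm (p - a))\<^sup>2 - 2 * (r / d) * inner (b - a) (p - a) + r\<^sup>2"
  proof -
    have "(norm ((p - a) - s *\<^sub>R (b - a)))\<^sup>2
        = (norm (p - a))\<^sup>2 - 2 * s * inner (b - a) (p - a) + s\<^sup>2 * (norm (b - a))\<^sup>2" for s
      unfolding power2_norm_eq_inner
      by (simp add: inner_diff_left inner_diff_right inner_commute power2_eq_square algebra_simps)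
    then show ?thesis using d by (simp add: power_divide)
  qed
  also have "\<dots> \<le> 0"
  proof -
    have "d * r \<le> inner (b - a) (p - a)" using i na by simp
    then have "(r / d) * (d * r) \<le> (r / d) * inner (b - a) (p - a)"
      using d assms(1) by (intro mult_left_mono) auto
    then show ?thesis using na d by (simp add: power2_eq_square)
  qed
  finally show ?thesis by (simp add: d_def algebra_simps)
qed

text \<open>Multiplying the sum of the two unit vectors by both lengths clears the denominators and
  exhibits \<open>y\<close> as a convex combination, each endpoint weighted by the distance to the
  other one. It serves to recognise the absence of a velocity change at a reflection.\<close>

lemma sgn_opposite_imp_in_segment:
  fixes x y z :: "'a::real_normed_vector"
  assumes "x \<noteq> y" "z \<noteq> y" "sgn (x - y) + sgn (z - y) = 0"
  shows "y \<in> closed_segment x z"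
proof -
  define a b where "a = norm (x - y)" and "b = norm (z - y)"
  have ab: "0 < a" "0 < b" using assms by (auto simp: a_def b_def)
  have "(a * b) *\<^sub>R ((1 / a) *\<^sub>R (x - y) + (1 / b) *\<^sub>R (z - y)) = 0"
    using assms(3) by (simp add: sgn_div_norm a_def b_def divide_inverse)
  then have "b *\<^sub>R (x - y) + a *\<^sub>R (z - y) = 0"
    using ab by (simp add: scaleR_add_right)
  then have e: "(a + b) *\<^sub>R y = b *\<^sub>R x + a *\<^sub>R z" by (simp add: algebra_simps)
  have "y = (1 / (a + b)) *\<^sub>R ((a + b) *\<^sub>R y)" using ab by simp
  also have "\<dots> = (b / (a + b)) *\<^sub>R x + (a / (a + b)) *\<^sub>R z"
    unfolding e by (simp add: scaleR_add_right)
  also have "b / (a + b) = 1 - a / (a + b)" using ab by (simp add: field_simps)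
  finally show ?thesis
    using ab by (auto simp: in_segment intro!: exI[of _ "a / (a + b)"])
qed

section \<open>Disjoint balls and projection onto the hull of their nearest points\<close>

locale disjoint_balls =
  fixes I :: "'i set" and c :: "'i \<Rightarrow> 'a::euclidean_space" and r :: "'i \<Rightarrow> real"
  assumes finite_I: "finite I"
    and r_pos: "\<And>i. i \<in> I \<Longrightarrow> 0 < r i"
    and disjoint: "\<And>i j. i \<in> I \<Longrightarrow> j \<in> I \<Longrightarrow> i \<noteq> j \<Longrightarrow> cball (c i) (r i) \<inter> cball (c j) (r j) = {}"
begin

definition scatterer :: "'a set" where
  "scatterer = (\<Union>i\<in>I. cball (c i) (r i))"

text \<open>The point where the segment from \<open>c i\<close> to \<open>c j\<close> leaves ball
  \<open>i\<close>. By \<open>nearest_point_between_cballs\<close> it is the component in ball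
  \<open>i\<close> of the distance minimiser for the pair.\<close>

definition nearest :: "'i \<Rightarrow> 'i \<Rightarrow> 'a" where
  "nearest i j = c i + (r i / dist (c i) (c j)) *\<^sub>R (c j - c i)"

definition nearest_hull :: "'a set" where
  "nearest_hull = convex hull {nearest i j | i j. i \<in> I \<and> j \<in> I \<and> i \<noteq> j}"

text \<open>Otherwise the point dividing the segment of centres in the ratio \<open>r i\<close> to
  \<open>r j\<close> would lie in both balls.\<close>

lemma sum_radii_less_dist:
  assumes "i \<in> I" "j \<in> I" "i \<noteq> j"
  shows "r i + r j < dist (c i) (c j)"
proof (rule ccontr)
  assume "\<not> ?thesis"
  then have le: "norm (c j - c i) \<le> r i + r j" by (simp add: dist_norm norm_minus_commute)
  have pos: "0 < r i" "0 < r j" using r_pos assms by auto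
  define s where "s = r i / (r i + r j)"
  have s: "0 \<le> s" "s \<le> 1" "s * (r i + r j) = r i" "(1 - s) * (r i + r j) = r j"
    using pos by (auto simp: s_def field_simps)
  define x where "x = c i + s *\<^sub>R (c j - c i)"
  have "norm (c i - x) = s * norm (c j - c i)" using s by (simp add: x_def)
  moreover have "c j - x = (1 - s) *\<^sub>R (c j - c i)" by (simp add: x_def algebra_simps)
  then have "norm (c j - x) = (1 - s) * norm (c j - c i)" using s by simp
  ultimately have "norm (c i - x) \<le> r i" "norm (c j - x) \<le> r j"
    using mult_left_mono[OF le, of s] mult_left_mono[OF le, of "1 - s"] s by auto
  then have "x \<in> cball (c i) (r i) \<inter> cball (c j) (r j)" by (simp add: dist_norm)
  then show False using disjoint[OF assms] by blast
qed

lemma compact_scatterer: "compact scatterer"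
  unfolding scatterer_def using finite_I by (intro compact_UN) auto

lemma compact_nearest_hull: "compact nearest_hull"
proof -
  have "{nearest i j | i j. i \<in> I \<and> j \<in> I \<and> i \<noteq> j} \<subseteq> (\<lambda>(i, j). nearest i j) ` (I \<times> I)" by auto
  then have "finite {nearest i j | i j. i \<in> I \<and> j \<in> I \<and> i \<noteq> j}"
    by (rule finite_subset) (simp add: finite_I)
  then show ?thesis
    unfolding nearest_hull_def by (intro compact_convex_hull finite_imp_compact)
qed

lemma nearest_in_cball: "i \<in> I \<Longrightarrow> nearest i j \<in> cball (c i) (r i)"
  using r_pos[of i] by (auto simp: nearest_def dist_norm norm_minus_commute)

text \<open>The residual \<open>\<xi> = x - y\<close> is normal to a plane supporting the hull at
  \<open>y\<close>, at height \<open>h\<close>. If the centre of the ball is not above this plane,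
  passing from \<open>x\<close> to \<open>y\<close> does not increase the distance to the centre.
  Otherwise \<open>y\<close> is a convex combination of points \<open>nearest i j\<close>, all of
  which lie in the ball.\<close>

lemma closest_point_nearest_hull_in_cball:
  assumes ne: "nearest_hull \<noteq> {}" and i: "i \<in> I" and x: "x \<in> cball (c i) (r i)"
  shows "closest_point nearest_hull x \<in> cball (c i) (r i)"
proof -
  define y where "y = closest_point nearest_hull x"
  define \<xi> where "\<xi> = x - y"
  define h where "h = inner \<xi> y"
  have cl: "closed nearest_hull" "convex nearest_hull"
    using compact_nearest_hull compact_imp_closed by (auto simp: nearest_hull_def)
  have yH: "y \<in> nearest_hull" unfolding y_def by (rule closest_point_in_set[OF cl(1) ne])
  have hmax: "inner \<xi> p \<le> h" if "p \<in> nearest_hull" for p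
    using closest_point_dot[OF cl(2,1) that, of x]
    by (simp add: \<xi>_def h_def y_def inner_diff_right)
  have "y \<in> cball (c i) (r i)"
  proof (cases "inner \<xi> (c i) \<le> h")
    case True
    \<comment> \<open>\<open>y\<close> is obtained by lowering \<open>x\<close> along \<open>\<xi>\<close> to a height not below that of \<open>c i\<close>.\<close>
    have "(norm (x - c i))\<^sup>2 = (norm (y - c i))\<^sup>2 + 2 * inner \<xi> (y - c i) + (norm \<xi>)\<^sup>2"
      unfolding power2_norm_eq_inner by (simp add: \<xi>_def algebra_simps inner_commute)
    then have "(norm (y - c i))\<^sup>2 \<le> (norm (x - c i))\<^sup>2"
      using True zero_le_power2[of "norm \<xi>"] unfolding h_def inner_diff_right by argo
    then have "norm (y - c i) \<le> norm (x - c i)" by simp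
    then show ?thesis using x by (simp add: dist_norm norm_minus_commute)
  next
    case False
    \<comment> \<open>The centre \<open>c i\<close> lies above the supporting plane at \<open>y\<close>. Along \<open>c i\<close>, \<open>nearest i j\<close>, \<open>nearest j i\<close>,
      \<open>c j\<close> the height then decreases, so only points \<open>nearest i j\<close> can span the face containing \<open>y\<close>.\<close>
    have in_hull: "nearest a b \<in> nearest_hull" if "a \<in> I" "b \<in> I" "a \<noteq> b" for a b
      unfolding nearest_hull_def using that by (intro hull_inc) auto
    have height: "inner \<xi> (nearest a b)
        = inner \<xi> (c a) + (r a / dist (c a) (c b)) * inner \<xi> (c b - c a)" for a b
      by (simp add: nearest_def inner_add_right)
    have low: "inner \<xi> (c j) < h \<and> inner \<xi> (nearest j i) < h" if j: "j \<in> I" "j \<noteq> i" for j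
    proof -
      define d where "d = dist (c i) (c j)"
      define D where "D = inner \<xi> (c j - c i)"
      have d: "r i + r j < d" "0 < r i" "0 < r j" "0 < d"
        using sum_radii_less_dist[of i j] r_pos[of i] r_pos[of j] i j by (auto simp: d_def)
      have 1: "inner \<xi> (c i) + (r i / d) * D \<le> h"
        using hmax[OF in_hull[of i j]] i j unfolding height d_def D_def by auto
      then have "(r i / d) * D < 0" using False by linarith
      then have D: "D < 0" using d by (simp add: mult_less_0_iff divide_less_0_iff)
      have 2: "inner \<xi> (nearest j i) = inner \<xi> (c i) + (1 - r j / d) * D"
        unfolding height by (simp add: d_def D_def dist_commute inner_diff_right algebra_simps)
      have "r i / d < 1 - r j / d" using d by (simp add: field_simps)
      then have 3: "(1 - r j / d) * D < (r i / d) * D" using D by (rule mult_strict_right_mono_neg)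
      have "D < (1 - r j / d) * D" using d D by (simp add: field_simps mult_neg_pos)
      then have "inner \<xi> (c j) < inner \<xi> (c i) + (1 - r j / d) * D"
        by (simp add: D_def inner_diff_right algebra_simps)
      then show ?thesis using 1 2 3 by linarith
    qed
    \<comment> \<open>For \<open>b \<noteq> i\<close> the point is a convex combination of the
      centres \<open>c a\<close> and \<open>c b\<close>, both strictly below height
      \<open>h\<close>.\<close>
    have low2: "inner \<xi> (nearest a b) < h" if ab: "a \<in> I" "b \<in> I" "a \<noteq> b" "a \<noteq> i" for a b
    proof (cases "b = i")
      case False
      define s where "s = r a / dist (c a) (c b)"
      have "0 < r a" "r a < dist (c a) (c b)"
        using sum_radii_less_dist[of a b] r_pos[of a] r_pos[of b] ab by auto
      then have s: "0 \<le> s" "s < 1" unfolding s_def by (auto simp: divide_less_eq_1)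
      have "inner \<xi> (nearest a b) = (1 - s) * inner \<xi> (c a) + s * inner \<xi> (c b)"
        unfolding height by (simp add: s_def inner_diff_right algebra_simps)
      also have "\<dots> < h"
        using low[of a] low[of b] ab False s by (intro convex_bound_lt) auto
      finally show ?thesis .
    qed (use low ab in auto)
    \<comment> \<open>The generators of the hull are split by the ball they lie on: \<open>A\<close>
      spans a subset of ball \<open>i\<close>, while \<open>B\<close> spans only points strictly
      below the supporting plane.\<close>
    define A where "A = {nearest i j | j. j \<in> I \<and> j \<noteq> i}"
    define B where "B = {nearest a b | a b. a \<in> I \<and> b \<in> I \<and> a \<noteq> b \<and> a \<noteq> i}"
    have "{nearest a b | a b. a \<in> I \<and> b \<in> I \<and> a \<noteq> b} = A \<union> B"
      unfolding A_def B_def using i by blast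
    then have yAB: "y \<in> convex hull (A \<union> B)" using yH by (simp add: nearest_hull_def)
    have A: "convex hull A \<subseteq> cball (c i) (r i)"
      using nearest_in_cball[OF i] by (intro hull_minimal) (auto simp: A_def)
    have "convex hull B \<subseteq> {p. inner \<xi> p < h}"
      using low2 by (intro hull_minimal convex_halfspace_lt) (auto simp: B_def)
    then have B: "inner \<xi> b < h" if "b \<in> convex hull B" for b using that by auto
    show ?thesis
    proof (cases "A = {} \<or> B = {}")
      case True
      then show ?thesis using yAB A B[of y] by (auto simp: h_def)
    next
      case False
      have "A \<union> B \<subseteq> convex hull A \<union> convex hull B" by (intro Un_mono hull_subset)
      then have "y \<in> convex hull (convex hull A \<union> convex hull B)"
        using yAB hull_mono by blast
      then obtain s t a b where st: "0 \<le> s" "0 \<le> t" "s + t = 1" "a \<in> convex hull A"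
        "b \<in> convex hull B" "y = s *\<^sub>R a + t *\<^sub>R b"
        using False by (subst (asm) convex_hull_union_two) auto
      moreover have "s = 1 - t" using st(3) by linarith
      ultimately have tab: "0 \<le> t" "t \<le> 1" "a \<in> convex hull A" "b \<in> convex hull B"
        and y: "y = (1 - t) *\<^sub>R a + t *\<^sub>R b"
        by simp_all
      have "A \<union> B \<subseteq> nearest_hull"
        using in_hull i by (auto simp: A_def B_def)
      then have "convex hull A \<subseteq> nearest_hull" using cl(2) by (intro hull_minimal) auto
      then have "inner \<xi> a \<le> h" using hmax tab(3) by blast
      \<comment> \<open>Since \<open>y\<close> has height exactly \<open>h\<close> and no point of
        the hull is higher, positive weight on a point strictly below \<open>h\<close> is
        impossible.\<close>
      have "t = 0"
      proof (rule ccontr)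
        assume "t \<noteq> 0"
        then have "t * inner \<xi> b < t * h" using B[OF tab(4)] tab(1) by simp
        moreover have "(1 - t) * inner \<xi> a \<le> (1 - t) * h"
          using \<open>inner \<xi> a \<le> h\<close> tab(2) by (intro mult_left_mono) auto
        moreover have "h = (1 - t) * inner \<xi> a + t * inner \<xi> b"
          unfolding h_def by (subst y) (simp add: inner_add_right)
        ultimately have "h < (1 - t) * h + t * h" by linarith
        then show False by (simp add: algebra_simps)
      qed
      then show ?thesis using y tab(3) A by auto
    qed
  qed
  then show ?thesis by (simp add: y_def)
qed

section \<open>Boundary, normals and single reflections of the scatterer\<close>

text \<open>The other balls form a closed set missing \<open>q\<close>. This reduces local questions
  about the scatterer to a single ball.\<close>

lemma eventually_scatterer_in_cball:
  assumes "i \<in> I" "q \<in> cball (c i) (r i)"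
  shows "\<forall>\<^sub>F x in nhds q. x \<in> scatterer \<longrightarrow> x \<in> cball (c i) (r i)"
proof -
  have "closed (\<Union>j\<in>I - {i}. cball (c j) (r j))" using finite_I by (intro closed_UN) auto
  moreover have "q \<notin> (\<Union>j\<in>I - {i}. cball (c j) (r j))"
    using disjoint[of i] assms by blast
  ultimately have "\<forall>\<^sub>F x in nhds q. x \<in> - (\<Union>j\<in>I - {i}. cball (c j) (r j))"
    by (intro eventually_nhds_in_open open_Compl) blast+
  then show ?thesis
    by (rule eventually_mono) (auto simp: scatterer_def)
qed

lemma eventually_outside:
  assumes "i \<in> I" "norm (q - c i) = r i"
  shows "\<forall>\<^sub>F t in at_right 0. q + t *\<^sub>R ((q - c i) /\<^sub>R r i) \<notin> scatterer"
proof -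
  let ?n = "(q - c i) /\<^sub>R r i"
  have "((\<lambda>t. q + t *\<^sub>R ?n) \<longlongrightarrow> q + 0 *\<^sub>R ?n) (at_right 0)"
    by (intro tendsto_intros)
  then have lim: "((\<lambda>t. q + t *\<^sub>R ?n) \<longlongrightarrow> q) (at_right 0)" by simp
  have q: "q \<in> cball (c i) (r i)" using assms by (simp add: dist_norm norm_minus_commute)
  have "\<forall>\<^sub>F t in at_right 0. q + t *\<^sub>R ?n \<in> scatterer \<longrightarrow> q + t *\<^sub>R ?n \<in> cball (c i) (r i)"
    using eventually_scatterer_in_cball[OF assms(1) q] lim by (rule eventually_compose_filterlim)
  moreover have "\<forall>\<^sub>F t in at_right (0::real). 0 < t" by (rule eventually_at_right_less)
  ultimately show ?thesis
  proof eventually_elim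
    case (elim t)
    have rp: "0 < r i" using r_pos assms by auto
    have "c i - (q + t *\<^sub>R ?n) = - ((1 + t / r i) *\<^sub>R (q - c i))"
      by (simp add: algebra_simps divide_inverse)
    then have "dist (c i) (q + t *\<^sub>R ?n) = (1 + t / r i) * r i"
      unfolding dist_norm using assms(2) rp elim(2) by simp
    then have "r i < dist (c i) (q + t *\<^sub>R ?n)" using rp elim(2) by (simp add: algebra_simps)
    then show ?case using elim(1) by auto
  qed
qed

text \<open>The open ball lies in the interior of the scatterer, whereas a point of the sphere is a
  limit of outside points along its radius.\<close>

lemma frontier_scatterer_iff:
  assumes "i \<in> I" "q \<in> cball (c i) (r i)"
  shows "q \<in> frontier scatterer \<longleftrightarrow> norm (q - c i) = r i"
proof
  assume "q \<in> frontier scatterer"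
  then have "q \<notin> interior scatterer" by (simp add: frontier_def)
  moreover have "ball (c i) (r i) \<subseteq> interior scatterer"
    using assms by (intro interior_maximal) (auto simp: scatterer_def intro!: bexI[of _ i])
  ultimately have "q \<notin> ball (c i) (r i)" by blast
  then show "norm (q - c i) = r i"
    using assms(2) by (simp add: dist_norm norm_minus_commute)
next
  assume n: "norm (q - c i) = r i"
  let ?n = "(q - c i) /\<^sub>R r i"
  have "((\<lambda>t. q + t *\<^sub>R ?n) \<longlongrightarrow> q + 0 *\<^sub>R ?n) (at_right 0)"
    by (intro tendsto_intros)
  then have lim: "((\<lambda>t. q + t *\<^sub>R ?n) \<longlongrightarrow> q) (at_right 0)" by simp
  have "q \<notin> interior scatterer"
  proof
    assume "q \<in> interior scatterer"
    then have "\<forall>\<^sub>F t in at_right 0. q + t *\<^sub>R ?n \<in> interior scatterer"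
      using lim by (auto intro: topological_tendstoD)
    with eventually_outside[OF assms(1) n]
    have "\<forall>\<^sub>F t in at_right (0::real). False"
      by eventually_elim (use interior_subset in blast)
    then show False by simp
  qed
  moreover have "q \<in> scatterer" using assms by (auto simp: scatterer_def)
  ultimately show "q \<in> frontier scatterer"
    using closure_subset by (auto simp: frontier_def)
qed

text \<open>A boundary curve through \<open>q\<close> stays on the sphere of ball \<open>i\<close>
  for small times, so its squared distance to the centre is locally constant. The derivative of that
  distance, \<open>2 * inner (q - c i) w\<close>, therefore vanishes.\<close>

lemma is_outward_unit_normal_sphere:
  assumes "i \<in> I" and n: "norm (q - c i) = r i"
  shows "is_outward_unit_normal scatterer q ((q - c i) /\<^sub>R r i)"
proof -
  have rp: "0 < r i" using r_pos assms by auto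
  have q: "q \<in> cball (c i) (r i)" using n by (simp add: dist_norm norm_minus_commute)
  have "inner ((q - c i) /\<^sub>R r i) w = 0"
    if \<gamma>: "\<forall>t::real. \<gamma> t \<in> frontier scatterer" "\<gamma> 0 = q"
      and d: "(\<gamma> has_vector_derivative w) (at 0)" for \<gamma> w
  proof -
    have fin: "frontier scatterer \<subseteq> scatterer"
      using compact_scatterer by (simp add: compact_imp_closed frontier_subset_closed)
    have "isCont \<gamma> 0" using d by (rule has_vector_derivative_continuous)
    then have "filterlim \<gamma> (nhds q) (nhds 0)"
      using \<gamma>(2) by (simp add: isCont_def tendsto_nhds_iff)
    with eventually_scatterer_in_cball[OF assms(1) q]
    have "\<forall>\<^sub>F t in nhds 0. \<gamma> t \<in> scatterer \<longrightarrow> \<gamma> t \<in> cball (c i) (r i)"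
      by (rule eventually_compose_filterlim)
    then have ev: "\<forall>\<^sub>F t in nhds 0. inner (\<gamma> t - c i) (\<gamma> t - c i) = (r i)\<^sup>2"
    proof eventually_elim
      case (elim t)
      then have "\<gamma> t \<in> cball (c i) (r i)" using \<gamma>(1) fin by blast
      then have "norm (\<gamma> t - c i) = r i"
        using frontier_scatterer_iff[OF assms(1)] \<gamma>(1) by blast
      then show ?case by (simp add: power2_norm_eq_inner[symmetric])
    qed
    have "((\<lambda>t. \<gamma> t - c i) has_vector_derivative w) (at 0)"
      using d by (auto intro!: derivative_eq_intros)
    then have "((\<lambda>t. inner (\<gamma> t - c i) (\<gamma> t - c i)) has_derivative
        (\<lambda>h. inner (\<gamma> 0 - c i) (h *\<^sub>R w) + inner (h *\<^sub>R w) (\<gamma> 0 - c i))) (at 0)"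
      unfolding has_vector_derivative_def by (intro has_derivative_inner)
    then have "((\<lambda>t. inner (\<gamma> t - c i) (\<gamma> t - c i)) has_real_derivative 2 * inner (q - c i) w) (at 0)"
      unfolding has_field_derivative_def
      by (rule has_derivative_eq_rhs) (auto simp: \<gamma>(2) inner_commute)
    moreover have "((\<lambda>t. inner (\<gamma> t - c i) (\<gamma> t - c i)) has_real_derivative 0) (at 0)"
      using DERIV_cong_ev[OF refl ev refl, THEN iffD2] by simp
    ultimately have "2 * inner (q - c i) w = 0" by (rule DERIV_unique)
    then show ?thesis by simp
  qed
  then show ?thesis
    unfolding is_outward_unit_normal_def
    using eventually_outside[OF assms] n rp by auto
qed

text \<open>Uniqueness: orthogonality to great circles removes any tangential component of a
  competing normal, leaving \<open>?n\<close> and \<open>- ?n\<close>, and the latter points into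
  the ball.\<close>

lemma outward_unit_normal_sphere:
  assumes "i \<in> I" and n: "norm (q - c i) = r i"
  shows "outward_unit_normal scatterer q = (q - c i) /\<^sub>R r i"
  unfolding outward_unit_normal_def
proof (rule the_equality)
  let ?n = "(q - c i) /\<^sub>R r i"
  show "is_outward_unit_normal scatterer q ?n"
    by (rule is_outward_unit_normal_sphere[OF assms])
  fix m assume m: "is_outward_unit_normal scatterer q m"
  have rp: "0 < r i" using r_pos assms by auto
  have n1: "norm ?n = 1" and nn: "inner ?n ?n = 1"
    using n rp by (auto simp: power2_norm_eq_inner[symmetric] dot_square_norm)
  define e where "e = m - inner m ?n *\<^sub>R ?n"
  have en: "inner e ?n = 0" using nn by (simp add: e_def inner_diff_left)
  have "e = 0"
  proof (rule ccontr)
    assume "e \<noteq> 0"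
    define f where "f = sgn e"
    have f: "inner f f = 1" "inner f ?n = 0" "inner ?n f = 0"
      using \<open>e \<noteq> 0\<close> en
      by (auto simp: f_def sgn_div_norm dot_square_norm power2_eq_square inner_commute)
    \<comment> \<open>The great circle through \<open>q\<close> whose initial direction is the
      normalised tangential component of \<open>m\<close>.\<close>
    define \<gamma> where "\<gamma> = (\<lambda>t. c i + (r i * cos t) *\<^sub>R ?n + (r i * sin t) *\<^sub>R f)"
    have "(norm (\<gamma> t - c i))\<^sup>2 = (r i)\<^sup>2" for t
    proof -
      have "(norm (\<gamma> t - c i))\<^sup>2 = (r i * cos t)\<^sup>2 + (r i * sin t)\<^sup>2"
        using norm_power2_orthonormal[OF nn f(1,3), of "r i * cos t" "r i * sin t"]
        by (simp only: \<gamma>_def add_diff_cancel_left' add.assoc)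
      also have "\<dots> = (r i)\<^sup>2 * ((cos t)\<^sup>2 + (sin t)\<^sup>2)"
        unfolding power_mult_distrib distrib_left ..
      finally show ?thesis by simp
    qed
    then have nr: "norm (\<gamma> t - c i) = r i" for t
      using rp by (simp add: power2_eq_iff_nonneg)
    have "\<gamma> t \<in> frontier scatterer" for t
      using nr[of t] frontier_scatterer_iff[OF assms(1), of "\<gamma> t"]
      by (simp add: dist_norm norm_minus_commute)
    moreover have "\<gamma> 0 = q" using rp by (simp add: \<gamma>_def)
    moreover have "(\<gamma> has_vector_derivative r i *\<^sub>R f) (at 0)"
      unfolding \<gamma>_def by (auto intro!: derivative_eq_intros)
    ultimately have "inner m (r i *\<^sub>R f) = 0"
      using m unfolding is_outward_unit_normal_def by blast
    then have "inner m f = 0" using rp by simp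
    then have "inner e f = 0" using f by (simp add: e_def inner_diff_left)
    moreover have "inner e f = norm e"
      using \<open>e \<noteq> 0\<close> by (simp add: f_def sgn_div_norm dot_square_norm power2_eq_square)
    ultimately show False using \<open>e \<noteq> 0\<close> by simp
  qed
  then have mm: "m = inner m ?n *\<^sub>R ?n" by (simp add: e_def)
  have "norm m = norm (inner m ?n *\<^sub>R ?n)" using mm by (rule arg_cong)
  also have "\<dots> = \<bar>inner m ?n\<bar>" unfolding norm_scaleR[of _ ?n] n1 by simp
  finally have "norm m = \<bar>inner m ?n\<bar>" .
  then have "inner m ?n = 1 \<or> inner m ?n = -1"
    using m by (auto simp: is_outward_unit_normal_def)
  then show "m = ?n"
  proof
    assume "inner m ?n = -1"
    then have m': "m = - ?n" using mm by simp
    have "\<forall>\<^sub>F t in at_right 0. q + t *\<^sub>R m \<notin> scatterer"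
      using m by (simp add: is_outward_unit_normal_def)
    \<comment> \<open>For \<open>t < r i\<close> the factor \<open>1 - t / r i\<close> is positive,
      so moving along \<open>- ?n\<close> stays inside the ball.\<close>
    moreover have "\<forall>\<^sub>F t in at_right 0. 0 < t \<and> t < r i"
      using rp eventually_at_right_real[of 0 "r i"] by (auto elim: eventually_mono)
    ultimately have "\<forall>\<^sub>F t in at_right (0::real). False"
    proof eventually_elim
      case (elim t)
      have "q + t *\<^sub>R m - c i = (1 - t / r i) *\<^sub>R (q - c i)"
        unfolding m' by (simp add: algebra_simps divide_inverse)
      then have "norm (q + t *\<^sub>R m - c i) = (1 - t / r i) * r i"
        using n rp elim(2) by simp
      then have "norm (q + t *\<^sub>R m - c i) \<le> r i" using rp elim(2) by (simp add: algebra_simps)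
      then have "q + t *\<^sub>R m \<in> cball (c i) (r i)" by (simp add: dist_norm norm_minus_commute)
      then show ?case using elim(1) assms(1) by (auto simp: scatterer_def)
    qed
    then show ?thesis by simp
  qed (use mm in simp)
qed

text \<open>Unfolds one application of the billiard map into vector equations. Reflection reverses
  the normal component, so the velocity jump can be written with the outgoing velocity, which makes
  its coefficient along \<open>n\<close> nonnegative.\<close>

lemma billiard_step:
  assumes dom: "x \<in> billiard_dom scatterer" and map: "billiard_map scatterer x = y"
    and y: "y \<in> billiard_phase_space scatterer"
    and i: "i \<in> I" "fst x \<in> cball (c i) (r i)" and j: "j \<in> I" "fst y \<in> cball (c j) (r j)"
  obtains t n where "0 < t" "fst y = fst x + t *\<^sub>R snd x" "i \<noteq> j"
    "n = (fst y - c j) /\<^sub>R r j" "norm (fst y - c j) = r j" "0 \<le> inner (snd y) n"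
    "snd y - snd x = (2 * inner (snd y) n) *\<^sub>R n"
proof -
  obtain t where t: "is_next_reflection_time scatterer x t"
    using dom by (auto simp: billiard_dom_def)
  \<comment> \<open>Of two distinct candidates, the smaller lies on the boundary, while the larger
    requires free flight there.\<close>
  have the_t: "(THE t. is_next_reflection_time scatterer x t) = t"
  proof (rule the_equality)
    show "is_next_reflection_time scatterer x t" by (rule t)
    fix s assume "is_next_reflection_time scatterer x s"
    with t show "s = t"
      unfolding is_next_reflection_time_def by (metis DiffE linorder_neqE)
  qed
  define n where "n = (fst y - c j) /\<^sub>R r j"
  have t0: "0 < t" using t by (simp add: is_next_reflection_time_def)
  have y1: "fst y = fst x + t *\<^sub>R snd x"
    and y2: "snd y = reflected_velocity (outward_unit_normal scatterer (fst y)) (snd x)"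
    using map by (auto simp: billiard_map_def the_t Let_def)
  have fr: "fst y \<in> frontier scatterer" using y by (auto simp: billiard_phase_space_def)
  then have nr: "norm (fst y - c j) = r j" using frontier_scatterer_iff j by blast
  then have out: "outward_unit_normal scatterer (fst y) = n"
    using outward_unit_normal_sphere j n_def by simp
  have rj: "0 < r j" using r_pos j by auto
  have nn: "inner n n = 1"
    using nr rj by (simp add: n_def dot_square_norm power2_eq_square)
  have pos: "0 \<le> inner (snd y) n"
    using y out by (auto simp: billiard_phase_space_def inner_commute)
  have "inner (snd y) n = - inner (snd x) n"
    unfolding y2 out reflected_velocity_def using nn by (simp add: inner_diff_left)
  then have "snd y - snd x = (2 * inner (snd y) n) *\<^sub>R n"
    unfolding y2 out reflected_velocity_def by simp
  moreover have "i \<noteq> j"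
  proof
    assume "i = j"
    \<comment> \<open>If both ends lay in the same ball, convexity would put the midpoint of the
      free path in the scatterer.\<close>
    have mid: "fst x + (t / 2) *\<^sub>R snd x = (1 / 2) *\<^sub>R fst x + (1 / 2) *\<^sub>R fst y"
      unfolding y1 by (simp add: scaleR_add_right flip: scaleR_add_left)
    have "fst x + (t / 2) *\<^sub>R snd x \<in> cball (c i) (r i)"
      unfolding mid using i(2) j(2) \<open>i = j\<close> by (intro convexD convex_cball) auto
    then have "fst x + (t / 2) *\<^sub>R snd x \<in> scatterer"
      using i by (auto simp: scatterer_def)
    moreover have "fst x + (t / 2) *\<^sub>R snd x \<in> closure (- scatterer) - frontier scatterer"
      using t t0 unfolding is_next_reflection_time_def billiard_table_def by auto
    ultimately show False
      using closure_subset by (auto simp: frontier_def closure_complement)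
  qed
  ultimately show thesis using that t0 y1 n_def nr pos by blast
qed

end

section \<open>Orbits under the no-eclipse condition\<close>

locale open_billiard_balls = disjoint_balls I c r
  for I :: "'i set" and c :: "'i \<Rightarrow> 'a::euclidean_space" and r :: "'i \<Rightarrow> real" +
  assumes no_eclipse: "\<And>i a b. i \<in> I \<Longrightarrow> a \<in> I \<Longrightarrow> b \<in> I \<Longrightarrow> a \<noteq> i \<Longrightarrow> b \<noteq> i \<Longrightarrow> a \<noteq> b \<Longrightarrow>
    convex hull (cball (c a) (r a) \<union> cball (c b) (r b)) \<inter> cball (c i) (r i) = {}"
begin

text \<open>The two unit vectors cancel only if \<open>y\<close> lies between \<open>x\<close> and
  \<open>z\<close>, which the no-eclipse condition forbids. The admissible triples form a compact
  set on which the norm of the sum is continuous and positive, hence bounded below. Applied to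
  consecutive reflection points, this bounds the velocity jump.\<close>

lemma no_grazing:
  obtains \<delta> where "0 < \<delta>"
    "\<And>i a b x y z. i \<in> I \<Longrightarrow> a \<in> I \<Longrightarrow> b \<in> I \<Longrightarrow> a \<noteq> i \<Longrightarrow> b \<noteq> i \<Longrightarrow> x \<in> cball (c a) (r a) \<Longrightarrow>
      y \<in> cball (c i) (r i) \<Longrightarrow> z \<in> cball (c b) (r b) \<Longrightarrow> \<delta> \<le> norm (sgn (x - y) + sgn (z - y))"
proof -
  define J where "J = {(i, a, b). i \<in> I \<and> a \<in> I \<and> b \<in> I \<and> a \<noteq> i \<and> b \<noteq> i}"
  define T where "T = (\<Union>(i, a, b)\<in>J. cball (c a) (r a) \<times> cball (c i) (r i) \<times> cball (c b) (r b))"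
  define g where "g = (\<lambda>(x, y, z). norm (sgn (x - y) + sgn (z - y :: 'a)))"
  have "J \<subseteq> I \<times> I \<times> I" by (auto simp: J_def)
  then have "finite J" using finite_I finite_subset by blast
  then have "compact T"
    unfolding T_def by (intro compact_UN) (auto intro!: compact_Times)
  have ne: "x \<noteq> y \<and> z \<noteq> y \<and> sgn (x - y) + sgn (z - y) \<noteq> 0" if "(x, y, z) \<in> T" for x y z
  proof -
    obtain i a b where iab: "i \<in> I" "a \<in> I" "b \<in> I" "a \<noteq> i" "b \<noteq> i"
      and xyz: "x \<in> cball (c a) (r a)" "y \<in> cball (c i) (r i)" "z \<in> cball (c b) (r b)"
      using \<open>(x, y, z) \<in> T\<close> by (auto simp: T_def J_def)
    have "x \<noteq> y" using disjoint[of a i] iab xyz by blast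
    moreover have "z \<noteq> y" using disjoint[of b i] iab xyz by blast
    moreover have "y \<notin> closed_segment x z"
    proof
      assume "y \<in> closed_segment x z"
      then have "y \<in> convex hull (cball (c a) (r a) \<union> cball (c b) (r b))"
        using xyz hull_mono[of "{x, z}" "cball (c a) (r a) \<union> cball (c b) (r b)" convex]
        by (auto simp: segment_convex_hull)
      \<comment> \<open>For \<open>a = b\<close> the hull is the ball itself, and disjointness takes
        the place of the no-eclipse condition.\<close>
      then show False
        using no_eclipse[of i a b] disjoint[of a i] iab xyz
        by (cases "a = b") (auto simp: convex_hull_eq[THEN iffD2, OF convex_cball])
    qed
    ultimately show ?thesis using sgn_opposite_imp_in_segment by blast
  qed
  have "continuous_on T g"
    unfolding g_def split_beta
    by (intro continuous_intros continuous_on_sgn) (use ne in auto)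
  have "\<exists>\<delta>>0. \<forall>p\<in>T. \<delta> \<le> g p"
  \<comment> \<open>A minimum exists on a nonempty compact set; without any triple the arbitrary
    value 1 serves.\<close>
  proof (cases "T = {}")
    case False
    then obtain p where "p \<in> T" "\<forall>p'\<in>T. g p \<le> g p'"
      using continuous_attains_inf \<open>compact T\<close> \<open>continuous_on T g\<close> by blast
    moreover have "0 < g p" using ne \<open>p \<in> T\<close> by (cases p) (auto simp: g_def)
    ultimately show ?thesis by blast
  qed (auto intro: exI[of _ 1])
  then obtain \<delta> where "0 < \<delta>" and \<delta>: "\<And>p. p \<in> T \<Longrightarrow> \<delta> \<le> g p" by blast
  show thesis
  proof (rule that[OF \<open>0 < \<delta>\<close>])
    fix i a b x y z
    assume "i \<in> I" "a \<in> I" "b \<in> I" "a \<noteq> i" "b \<noteq> i" "x \<in> cball (c a) (r a)"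
      "y \<in> cball (c i) (r i)" "z \<in> cball (c b) (r b)"
    then have "(x, y, z) \<in> T" unfolding T_def J_def by blast
    from \<delta>[OF this] show "\<delta> \<le> norm (sgn (x - y) + sgn (z - y))" by (simp add: g_def)
  qed
qed

lemma orbit_in_nearest_hull:
  fixes z :: "int \<Rightarrow> 'a \<times> 'a"
  assumes dom: "\<And>k. z k \<in> billiard_dom scatterer"
    and map: "\<And>k. billiard_map scatterer (z k) = z (k + 1)"
    and ne: "nearest_hull \<noteq> {}"
  shows "fst (z k) \<in> nearest_hull"
proof -
  define q where "q = (\<lambda>k. fst (z k))"
  define v where "v = (\<lambda>k. snd (z k))"
  have phase: "z k \<in> billiard_phase_space scatterer" for k
    using dom[of k] by (simp add: billiard_dom_def)
  have v1: "norm (v k) = 1" for k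
    using phase[of k] by (auto simp: billiard_phase_space_def v_def)
  have "q k \<in> scatterer" for k
    using phase[of k] frontier_subset_closed[OF compact_imp_closed[OF compact_scatterer]]
    by (auto simp: billiard_phase_space_def q_def)
  then have "\<forall>k. \<exists>i. i \<in> I \<and> q k \<in> cball (c i) (r i)" by (auto simp: scatterer_def)
  then obtain \<iota> where \<iota>: "\<And>k. \<iota> k \<in> I" and q\<iota>: "\<And>k. q k \<in> cball (c (\<iota> k)) (r (\<iota> k))" by metis
  define n where "n = (\<lambda>k. (q k - c (\<iota> k)) /\<^sub>R r (\<iota> k))"
  define \<mu> where "\<mu> = (\<lambda>k. 2 * inner (v k) (n k))"
  have step: "\<exists>t>0. q (k + 1) = q k + t *\<^sub>R v k \<and> \<iota> k \<noteq> \<iota> (k + 1) \<and>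
      norm (q (k + 1) - c (\<iota> (k + 1))) = r (\<iota> (k + 1)) \<and> 0 \<le> \<mu> (k + 1) \<and>
      v (k + 1) - v k = \<mu> (k + 1) *\<^sub>R n (k + 1)" for k
    by (rule billiard_step[OF dom[of k] map phase \<iota> _ \<iota>, of k "k + 1"])
      (use q\<iota> in \<open>auto simp: q_def v_def n_def \<mu>_def\<close>)
  \<comment> \<open>Every point of a two-sided orbit has a predecessor, so facts about arrival at
    \<open>q k\<close> come from step \<open>k - 1\<close>.\<close>
  have norm_n: "norm (q k - c (\<iota> k)) = r (\<iota> k)" "0 \<le> \<mu> k" for k
    using step[of "k - 1"] by auto
  have rp: "0 < r (\<iota> k)" for k using r_pos \<iota> by blast
  have n1: "norm (n k) = 1" for k using norm_n(1)[of k] rp[of k] by (simp add: n_def)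
  have vel: "v k - v (k - 1) = \<mu> k *\<^sub>R n k" for k using step[of "k - 1"] by auto
  have sgn_next: "sgn (q (k + 1) - q k) = v k" and sgn_prev: "sgn (q k - q (k + 1)) = - v k" for k
  proof -
    obtain t where t: "0 < t" "q (k + 1) = q k + t *\<^sub>R v k" using step by blast
    then have "sgn (q (k + 1) - q k) = v k" using v1[of k] by (simp add: sgn_div_norm)
    then show "sgn (q (k + 1) - q k) = v k" "sgn (q k - q (k + 1)) = - v k"
      using sgn_minus[of "q (k + 1) - q k"] by auto
  qed
  obtain \<delta> where "0 < \<delta>" and \<delta>: "\<And>i a b x y z. i \<in> I \<Longrightarrow> a \<in> I \<Longrightarrow> b \<in> I \<Longrightarrow> a \<noteq> i \<Longrightarrow> b \<noteq> i \<Longrightarrow>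
      x \<in> cball (c a) (r a) \<Longrightarrow> y \<in> cball (c i) (r i) \<Longrightarrow> z \<in> cball (c b) (r b) \<Longrightarrow>
      \<delta> \<le> norm (sgn (x - y) + sgn (z - y))"
    by (rule no_grazing) blast
  have \<mu>: "\<delta> \<le> \<mu> k" for k
  proof -
    \<comment> \<open>The directions from \<open>q k\<close> to its two neighbours are
      \<open>- v (k - 1)\<close> and \<open>v k\<close>, so their sum is the velocity jump at
      \<open>q k\<close>.\<close>
    have "\<delta> \<le> norm (sgn (q (k - 1) - q k) + sgn (q (k + 1) - q k))"
      by (rule \<delta>[OF \<iota>[of k] \<iota>[of "k - 1"] \<iota>[of "k + 1"] _ _ q\<iota> q\<iota> q\<iota>])
        (use step[of k] step[of "k - 1"] in auto)
    also have "\<dots> = norm (v k - v (k - 1))"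
      using sgn_next[of k] sgn_prev[of "k - 1"] by simp
    also have "\<dots> = \<mu> k" using vel[of k] n1[of k] norm_n(2)[of k] by simp
    finally show ?thesis .
  qed
  define R where "R = Max (r ` I)"
  have R: "r (\<iota> k) \<le> R" for k using finite_I \<iota> by (simp add: R_def)
  have "0 < R" using rp[of 0] R[of 0] by linarith
  define P where "P = closest_point nearest_hull"
  have cl: "closed nearest_hull" "convex nearest_hull"
    using compact_nearest_hull compact_imp_closed by (auto simp: nearest_hull_def)
  define y where "y = (\<lambda>k. q k - P (q k))"
  define a where "a = (\<lambda>k. inner (y k) (v (k - 1)))"
  \<comment> \<open>The jump is at least \<open>\<delta>\<close> and strict convexity costs a factor
    of at most \<open>2 * R\<close>; the largest radius makes the constant uniform in
    \<open>k\<close>.\<close>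
  define \<epsilon> where "\<epsilon> = \<delta> / (2 * R)"
  have "0 < \<epsilon>" using \<open>0 < \<delta>\<close> \<open>0 < R\<close> by (simp add: \<epsilon>_def)
  have abs_a: "\<bar>a k\<bar> \<le> norm (y k)" for k
    using Cauchy_Schwarz_ineq2[of "y k" "v (k - 1)"] v1 by (simp add: a_def)
  have growth: "a k + \<epsilon> * (norm (y k))\<^sup>2 \<le> a (k + 1)" for k
  proof -
    obtain t where t: "0 < t" "q (k + 1) = q k + t *\<^sub>R v k" using step by blast
    \<comment> \<open>As \<open>v k\<close> is the unit direction of the link, pairing with it gives
      the full length of the link and at most the length of the projected link. Subtraction leaves
      \<open>inner (y k) (v k) \<le> a (k + 1)\<close>.\<close>
    have "inner (P (q (k + 1)) - P (q k)) (v k) \<le> norm (P (q (k + 1)) - P (q k))"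
      using norm_cauchy_schwarz[of "P (q (k + 1)) - P (q k)" "v k"] v1 by simp
    also have "\<dots> \<le> norm (q (k + 1) - q k)"
      using closest_point_lipschitz[OF cl(2,1) ne, of "q (k + 1)" "q k"] by (simp add: P_def dist_norm)
    also have "\<dots> = inner (q (k + 1) - q k) (v k)"
      using t v1[of k] by (simp add: dot_square_norm)
    finally have "inner (y k) (v k) \<le> a (k + 1)"
      by (simp add: y_def a_def inner_diff_left)
    moreover have "inner (y k) (v k) = a k + \<mu> k * inner (y k) (n k)"
      using arg_cong[OF vel[of k], of "inner (y k)"] by (simp add: a_def inner_diff_right)
    moreover have "\<epsilon> * (norm (y k))\<^sup>2 \<le> \<mu> k * inner (y k) (n k)"
    proof -
      have "q k - y k \<in> cball (c (\<iota> k)) (r (\<iota> k))"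
        using closest_point_nearest_hull_in_cball[OF ne \<iota> q\<iota>] by (simp add: y_def P_def)
      then have *: "(norm (y k))\<^sup>2 \<le> 2 * r (\<iota> k) * inner (y k) (n k)"
        unfolding n_def by (rule norm_power2_le_inner_sphere_normal[OF rp norm_n(1)])
      \<comment> \<open>This sign permits the replacement of \<open>r (\<iota> k)\<close> by
        \<open>R\<close> and of \<open>\<delta>\<close> by \<open>\<mu> k\<close>.\<close>
      then have "0 \<le> inner (y k) (n k)"
        using rp[of k] by (smt (verit) mult_pos_neg zero_le_power2)
      then have "2 * r (\<iota> k) * inner (y k) (n k) \<le> 2 * R * inner (y k) (n k)"
        using R[of k] by (intro mult_right_mono) auto
      then have "\<epsilon> * (norm (y k))\<^sup>2 \<le> \<epsilon> * (2 * R * inner (y k) (n k))"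
        using * \<open>0 < \<epsilon>\<close> by (intro mult_left_mono) auto
      also have "\<dots> = \<delta> * inner (y k) (n k)" using \<open>0 < R\<close> by (simp add: \<epsilon>_def)
      also have "\<dots> \<le> \<mu> k * inner (y k) (n k)"
        using \<mu>[of k] \<open>0 \<le> inner (y k) (n k)\<close> by (rule mult_right_mono)
      finally show ?thesis .
    qed
    ultimately show ?thesis by linarith
  qed
  obtain B1 where B1: "\<And>x. x \<in> scatterer \<Longrightarrow> norm x \<le> B1"
    using compact_imp_bounded[OF compact_scatterer] by (auto simp: bounded_iff)
  obtain B2 where B2: "\<And>x. x \<in> nearest_hull \<Longrightarrow> norm x \<le> B2"
    using compact_imp_bounded[OF compact_nearest_hull] by (auto simp: bounded_iff)
  have a_bound: "\<bar>a k\<bar> \<le> B1 + B2" for k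
  proof -
    have "norm (y k) \<le> norm (q k) + norm (P (q k))" unfolding y_def by (rule norm_triangle_ineq4)
    moreover have "norm (P (q k)) \<le> B2"
      using closest_point_in_set[OF cl(1) ne] by (intro B2) (simp add: P_def)
    ultimately show ?thesis using abs_a[of k] B1[OF \<open>q k \<in> scatterer\<close>] by linarith
  qed
  have a_growth: "a k + \<epsilon> * (a k)\<^sup>2 \<le> a (k + 1)" for k
  proof -
    have "(a k)\<^sup>2 \<le> (norm (y k))\<^sup>2" using power_mono[OF abs_a[of k], of 2] by simp
    then have "\<epsilon> * (a k)\<^sup>2 \<le> \<epsilon> * (norm (y k))\<^sup>2" using \<open>0 < \<epsilon>\<close> by simp
    then show ?thesis using growth[of k] by linarith
  qed
  have "a k = 0" for k by (rule bounded_quadratic_growth_zero[where a = a, OF \<open>0 < \<epsilon>\<close> a_growth a_bound])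
  \<comment> \<open>Vanishing of \<open>a\<close> alone does not give \<open>y k = 0\<close>; the
    inequality \<open>growth\<close>, which retains the full norm of \<open>y k\<close>,
    does.\<close>
  then have "\<epsilon> * (norm (y k))\<^sup>2 \<le> 0" using growth[of k] by simp
  then have "y k = 0" using \<open>0 < \<epsilon>\<close> by (simp add: mult_le_0_iff)
  then have "q k = P (q k)" by (simp add: y_def)
  also have "\<dots> \<in> nearest_hull" unfolding P_def by (rule closest_point_in_set[OF cl(1) ne])
  finally show ?thesis by (simp add: q_def)
qed

end

section \<open>Periodic trajectories and the theorem for balls in space\<close>

text \<open>Reading the indices of the cycle modulo \<open>n\<close> over all integers unrolls it
  into a two-sided orbit.\<close>

lemma periodic_reflection_points_nonwandering:
  assumes "periodic_reflection_points K n q" "j \<in> {1..n}"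
  shows "q j \<in> fst ` billiard_nonwandering K"
proof -
  obtain v where v: "\<And>i. i \<in> {1..n} \<Longrightarrow> (q i, v i) \<in> billiard_dom K \<and>
      billiard_map K (q i, v i) = (q (i mod n + 1), v (i mod n + 1))"
    using assms(1) unfolding periodic_reflection_points_def by blast
  have n: "0 < n" using assms(2) by auto
  \<comment> \<open>Residues run from 0 to \<open>n - 1\<close> and indices from 1 to
    \<open>n\<close>, hence the final \<open>+ 1\<close>; the shift by \<open>int j - 1\<close>
    makes \<open>s 0 = j\<close>.\<close>
  define s where "s = (\<lambda>k. nat ((int j - 1 + k) mod int n) + 1)"
  have s: "s k \<in> {1..n}" for k
  proof -
    have "(int j - 1 + k) mod int n < int n" using n by simp
    then have "nat ((int j - 1 + k) mod int n) < n" using n by (simp add: nat_less_iff)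
    then show ?thesis by (simp add: s_def)
  qed
  have s_Suc: "s (k + 1) = s k mod n + 1" for k
  proof -
    have "int (nat ((int j - 1 + (k + 1)) mod int n)) = (int j - 1 + k + 1) mod int n"
      using n by (simp add: algebra_simps)
    also have "\<dots> = ((int j - 1 + k) mod int n + 1) mod int n" by (simp add: mod_add_left_eq)
    also have "\<dots> = int (s k mod n)" using n by (simp add: s_def zmod_int add.commute)
    finally have "nat ((int j - 1 + (k + 1)) mod int n) = s k mod n" by (simp only: of_nat_eq_iff)
    then show ?thesis by (simp only: s_def)
  qed
  have s0: "s 0 = j"
    using assms(2) n by (auto simp: s_def nat_diff_distrib)
  define z where "z = (\<lambda>k. (q (s k), v (s k)))"
  have "z k \<in> billiard_dom K \<and> billiard_map K (z k) = z (k + 1)" for k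
    using v[OF s[of k]] by (simp add: z_def s_Suc)
  moreover have "z 0 = (q j, v j)" by (simp add: z_def s0)
  moreover have "(q j, v j) \<in> billiard_phase_space K"
    using v[OF assms(2)] by (simp add: billiard_dom_def)
  ultimately have "(q j, v j) \<in> billiard_nonwandering K"
    unfolding billiard_nonwandering_def by blast
  then show ?thesis by force
qed

theorem mainTheorem2:
  fixes u :: nat
    and Ks :: "nat \<Rightarrow> (real ^ 3) set"
    and K H :: "(real ^ 3) set"
    and p :: "nat \<Rightarrow> nat \<Rightarrow> real ^ 3"
  assumes "u \<ge> 3"
    and "\<forall>i\<in>{1..u}. \<exists>c r. 0 < r \<and> Ks i = cball c r"
    and "\<forall>i\<in>{1..u}. \<forall>j\<in>{1..u}. i \<noteq> j \<longrightarrow> Ks i \<inter> Ks j = {}"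
    and "\<forall>i\<in>{1..u}. \<forall>j\<in>{1..u}. \<forall>k\<in>{1..u}. i \<noteq> j \<and> j \<noteq> k \<and> i \<noteq> k \<longrightarrow>
           convex hull (Ks i \<union> Ks j) \<inter> Ks k = {}"
    and "K = (\<Union>i\<in>{1..u}. Ks i)"
    and "\<forall>i\<in>{1..u}. \<forall>j\<in>{1..u}. i \<noteq> j \<longrightarrow>
           is_arg_min (\<lambda>(q\<^sub>1, q\<^sub>2). norm (q\<^sub>1 - q\<^sub>2)) (\<lambda>x. x \<in> Ks i \<times> Ks j) (p i j, p j i)"
    and "H = convex hull {p i j | i j. i \<in> {1..u} \<and> j \<in> {1..u} \<and> i \<noteq> j}"
  shows "(\<forall>(n::nat) (\<alpha> :: nat \<Rightarrow> nat) (q :: nat \<Rightarrow> real ^ 3).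
            n \<ge> 3 \<and> (\<forall>j\<in>{1..n}. \<alpha> j \<in> {1..u}) \<and>
            periodic_reflection_points K n q \<and> (\<forall>j\<in>{1..n}. q j \<in> Ks (\<alpha> j))
            \<longrightarrow> (\<forall>j\<in>{1..n}. q j \<in> H)) \<and>
         fst ` billiard_nonwandering K \<subseteq> H"
proof -
  obtain c r where cr: "\<And>i. i \<in> {1..u} \<Longrightarrow> 0 < r i \<and> Ks i = cball (c i) (r i)"
    using assms(2) by metis
  interpret open_billiard_balls "{1..u}" c r
  proof
    fix i j assume ij: "i \<in> {1..u}" "j \<in> {1..u}" "i \<noteq> j"
    then show "cball (c i) (r i) \<inter> cball (c j) (r j) = {}"
      using assms(3) cr[of i] cr[of j] by metis
  next
    fix i a b assume iab: "i \<in> {1..u}" "a \<in> {1..u}" "b \<in> {1..u}" "a \<noteq> i" "b \<noteq> i" "a \<noteq> b"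
    then show "convex hull (cball (c a) (r a) \<union> cball (c b) (r b)) \<inter> cball (c i) (r i) = {}"
      using assms(4) cr[of a] cr[of b] cr[of i] by metis
  qed (use cr in auto)
  have K: "K = scatterer" unfolding assms(5) scatterer_def using cr by (intro SUP_cong) auto
  \<comment> \<open>The minimisers are determined by centres and radii, which identifies
    \<open>H\<close> with \<open>nearest_hull\<close>.\<close>
  have p: "p i j = nearest i j" if ij: "i \<in> {1..u}" "j \<in> {1..u}" "i \<noteq> j" for i j
  proof -
    have am: "is_arg_min (\<lambda>(x, y). norm (x - y)) (\<lambda>x. x \<in> Ks i \<times> Ks j) (p i j, p j i)"
      using assms(6) ij by blast
    show ?thesis
      unfolding nearest_def
    proof (rule nearest_point_between_cballs[where s = "r j" and p' = "p j i"])
      show "p i j \<in> cball (c i) (r i)" "p j i \<in> cball (c j) (r j)"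
        using am cr ij by (auto simp: is_arg_min_def)
      show "norm (p i j - p j i) \<le> norm (x - y)"
        if "x \<in> cball (c i) (r i)" "y \<in> cball (c j) (r j)" for x y
        using am that cr[OF ij(1)] cr[OF ij(2)] unfolding is_arg_min_linorder by fastforce
    qed (use cr[OF ij(1)] cr[OF ij(2)] sum_radii_less_dist[OF ij] in auto)
  qed
  have "{p i j | i j. i \<in> {1..u} \<and> j \<in> {1..u} \<and> i \<noteq> j}
      = {nearest i j | i j. i \<in> {1..u} \<and> j \<in> {1..u} \<and> i \<noteq> j}"
    using p by (metis (no_types, opaque_lifting))
  then have H: "H = nearest_hull" by (simp only: assms(7) nearest_hull_def)
  \<comment> \<open>Closest points exist only for a nonempty hull; \<open>u \<ge> 3\<close> supplies
    the two distinct indices.\<close>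
  have "nearest 1 2 \<in> nearest_hull"
    unfolding nearest_hull_def using assms(1)
    by (intro hull_inc CollectI exI[of _ "1::nat"] exI[of _ "2::nat"]) auto
  then have "fst (z k) \<in> H"
    if "\<forall>k. z k \<in> billiard_dom K \<and> billiard_map K (z k) = z (k + 1)" for z and k :: int
    using orbit_in_nearest_hull[of z k] that unfolding H K by blast
  then have NW: "fst ` billiard_nonwandering K \<subseteq> H"
    unfolding billiard_nonwandering_def by blast
  show ?thesis
  proof (intro conjI allI impI ballI)
    fix n j :: nat and \<alpha> :: "nat \<Rightarrow> nat" and q :: "nat \<Rightarrow> real ^ 3"
    assume "n \<ge> 3 \<and> (\<forall>j\<in>{1..n}. \<alpha> j \<in> {1..u}) \<and> periodic_reflection_points K n q \<and>
      (\<forall>j\<in>{1..n}. q j \<in> Ks (\<alpha> j))" and "j \<in> {1..n}"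
    then have "q j \<in> fst ` billiard_nonwandering K"
      by (intro periodic_reflection_points_nonwandering) auto
    then show "q j \<in> H" using NW by (rule subsetD[rotated])
  qed (rule NW)
qed

end
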